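(* Fix $\zeta\in(0,1/2)$ and $\lambda>0$. Let $C,c>0$ be constants depending only on $\zeta$, and let $(G_n)$ and $(k_n)$, defined for all sufficiently large $n$, be $\zeta$-robust with constants $C,c$ (as defined in the context). Let $D_n$ be a uniformly random orientation of $G_n$. Then there is a constant $c_{\lambda,\zeta}>0$ such that, with probability tending to one as $n\to\infty$, every $W\subseteq V(G_n)$ with $|W|\ge\lambda n$ satisfies \[ \vec{\chi}(D_n[W])\ge c_{\lambda,\zeta}\sqrt{\frac n{\log n}}. \] In particular, with probability tending to one, deleting any set of at most $(1-\lambda)n$ vertices from $D_n$ leaves an oriented graph whose dichromatic number is still of the optimal order $\Theta(\sqrt{n/\log n})$ (with implied constants depending only on $\lambda,\zeta$).
   Context: All graphs are finite and simple; $\log$ is the natural logarithm; $e(G)$ is the number of edges of $G$; $G[U]$, $D[U]$ denote induced subgraphs/subdigraphs. A uniformly random orientation directs each edge independently, each direction having probability $1/2$. A vertex set of an oriented graph $D$ is acyclic if it induces no directed cycle; the acyclic number $\vec{\alpha}(D)$ is the maximum size of an acyclic vertex set; the dichromatic number $\vec{\chi}(D)$ is the minimum number of acyclic sets in a partition of $V(D)$; $\operatorname{fas}(D)$ is the minimum number of arcs whose deletion makes $D$ acyclic. Call $(G_n)$, $(k_n)$ $\zeta$-robust with constants $C,c$ if, for every sufficiently large $n$, $G_n$ is an $n$-vertex triangle-free graph, $k_n$ is an integer with $k_n\le C\sqrt{n\log n}$, and a uniformly random orientation $D_n$ of $G_n$ satisfies \[ \mathbb{P}\Bigl(\exists U\subseteq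 V(G_n),\ |U|\ge k_n:\ \operatorname{fas}(D_n[U])\le\bigl(\tfrac12-\zeta\bigr)e(G_n[U])\Bigr)\le \exp\bigl[-c\sqrt n\,(\log n)^{3/2}\bigr], \] and on the complementary event: (i) $\vec{\alpha}(D_n)<k_n$; (ii) every $W\subseteq V(G_n)$ with $|W|\ge k_n$ satisfies $\vec{\chi}(D_n[W])\ge|W|/(k_n-1)$; (iii) every digraph obtained from $D_n$ by fewer than $c\sqrt n\,(\log n)^{3/2}$ arc edits (each deleting or reversing one arc) has acyclic number less than $k_n$ and dichromatic number at least $n/(k_n-1)$. (The paper proves that for every $\zeta\in(0,1/2)$ such constants $C,c$ depending only on $\zeta$, and such graphs and integers, exist.) *)

theory Defs
  imports
    "HOL-Probability.Probability"
    "HOL-Probability.Product_PMF"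
    "HOL-Library.Disjoint_Sets"
    "Graph_Theory.Pair_Digraph"
    "Graph_Theory.Digraph_Component"
begin

record 'a ugraph =
  uverts :: "'a set"
  uedges :: "'a set set"

definition simple_graph :: "'a ugraph \<Rightarrow> bool" where
  "simple_graph G \<longleftrightarrow> finite (uverts G) \<and> (\<forall>e\<in>uedges G. e \<subseteq> uverts G \<and> card e = 2)"

definition triangle_free :: "'a ugraph \<Rightarrow> bool" where
  "triangle_free G \<longleftrightarrow>
     \<not> (\<exists>x y z. {x, y} \<in> uedges G \<and> {y, z} \<in> uedges G \<and> {x, z} \<in> uedges G)"

definition induced_ugraph :: "'a ugraph \<Rightarrow> 'a set \<Rightarrow> 'a ugraph" where
  "induced_ugraph G U = \<lparr> uverts = U, uedges = {e \<in> uedges G. e \<subseteq> U} \<rparr>"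

definition num_edges :: "'a ugraph \<Rightarrow> nat" where
  "num_edges G = card (uedges G)"

definition acyclic_digraph :: "('a, 'b) pre_digraph \<Rightarrow> bool" where
  "acyclic_digraph D \<longleftrightarrow> \<not> (\<exists>p. pre_digraph.cycle D p)"

definition acyclic_vertex_set :: "('a, 'b) pre_digraph \<Rightarrow> 'a set \<Rightarrow> bool" where
  "acyclic_vertex_set D U \<longleftrightarrow> U \<subseteq> verts D \<and> acyclic_digraph (D \<restriction> U)"

definition acyclic_number :: "('a, 'b) pre_digraph \<Rightarrow> nat" where
  "acyclic_number D = Max {card U | U. acyclic_vertex_set D U}"

definition dichromatic_number :: "('a, 'b) pre_digraph \<Rightarrow> nat" where
  "dichromatic_number D =
     (LEAST k. \<exists>P. partition_on (verts D) P \<and> finite P \<and> card P = k \<and>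
                   (\<forall>A\<in>P. acyclic_vertex_set D A))"

definition fas :: "('a, 'b) pre_digraph \<Rightarrow> nat" where
  "fas D = Min {card F | F. F \<subseteq> arcs D \<and> acyclic_digraph (D\<lparr>arcs := arcs D - F\<rparr>)}"

text \<open>An orientation is encoded by the function \<open>h\<close> that sends each edge to its head.\<close>

definition orient :: "'a ugraph \<Rightarrow> ('a set \<Rightarrow> 'a) \<Rightarrow> ('a, 'a \<times> 'a) pre_digraph" where
  "orient G h = with_proj
     \<lparr> pverts = uverts G, parcs = {(u, v). {u, v} \<in> uedges G \<and> h {u, v} = v} \<rparr>"

text \<open>
  The head of each edge \<open>e\<close> is chosen independently and uniformly from the two elements of \<open>e\<close>.
  The value \<open>undefined\<close> is only the default of \<open>h\<close> at sets that are not edges.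
\<close>

definition random_orientation :: "'a ugraph \<Rightarrow> ('a, 'a \<times> 'a) pre_digraph pmf" where
  "random_orientation G = map_pmf (orient G) (Pi_pmf (uedges G) undefined pmf_of_set)"

definition arc_edit :: "('a, 'a \<times> 'a) pre_digraph \<Rightarrow> ('a, 'a \<times> 'a) pre_digraph \<Rightarrow> bool" where
  "arc_edit D D' \<longleftrightarrow> (\<exists>u v. (u, v) \<in> arcs D \<and>
     (D' = pre_digraph.del_arc D (u, v) \<or>
      D' = pre_digraph.add_arc (pre_digraph.del_arc D (u, v)) (v, u)))"

definition small_fas_event ::
  "real \<Rightarrow> 'a ugraph \<Rightarrow> int \<Rightarrow> ('a, 'a \<times> 'a) pre_digraph set" where
  "small_fas_event \<zeta> G k =
     {D. \<exists>U \<subseteq> uverts G. int (card U) \<ge> k \<and>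
           real (fas (D \<restriction> U)) \<le> (1/2 - \<zeta>) * real (num_edges (induced_ugraph G U))}"

text \<open>
  Since there are finitely many orientations, each of positive probability, a property holding
  on the complementary event is one holding for every orientation in the support outside
  \<open>small_fas_event\<close>. The first of these properties forces \<open>k n \<ge> 2\<close>, so the
  denominators \<open>k n - 1\<close> are positive.
\<close>

definition robust ::
  "real \<Rightarrow> real \<Rightarrow> real \<Rightarrow> (nat \<Rightarrow> 'a ugraph) \<Rightarrow> (nat \<Rightarrow> int) \<Rightarrow> bool" where
  "robust \<zeta> C c G k \<longleftrightarrow> (\<forall>\<^sub>F n in sequentially.
     simple_graph (G n) \<and> card (uverts (G n)) = n \<and> triangle_free (G n) \<and>
     real_of_int (k n) \<le> C * sqrt (real n * ln (real n)) \<and>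
     measure_pmf.prob (random_orientation (G n)) (small_fas_event \<zeta> (G n) (k n))
       \<le> exp (- (c * sqrt (real n) * ln (real n) powr (3/2))) \<and>
     (\<forall>D \<in> set_pmf (random_orientation (G n)) - small_fas_event \<zeta> (G n) (k n).
        int (acyclic_number D) < k n \<and>
        (\<forall>W \<subseteq> uverts (G n). int (card W) \<ge> k n \<longrightarrow>
           real (dichromatic_number (D \<restriction> W)) \<ge> real (card W) / real_of_int (k n - 1)) \<and>
        (\<forall>m D'. real m < c * sqrt (real n) * ln (real n) powr (3/2) \<longrightarrow>
           (arc_edit ^^ m) D D' \<longrightarrow>
           int (acyclic_number D') < k n \<and>
           real (dichromatic_number D') \<ge> real n / real_of_int (k n - 1))))"

end

theory Submission
  imports Defs "HOL-Real_Asymp.Real_Asymp"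
begin

text \<open>
  The lower bound is property (ii) of robustness, since \<open>k n \<le> lam * n\<close> eventually. The upper bound
  holds for every orientation of every triangle-free graph, because independent sets are acyclic:
  by Alon's argument, a uniformly random independent set of a triangle-free graph on \<open>m\<close> vertices
  with maximum degree at most \<open>d\<close> has expected size at least \<open>m * ln d / (16 * d)\<close>. As
  neighbourhoods are independent, this gives an independent set of order \<open>sqrt (m * ln m)\<close>, and
  removing such sets greedily until \<open>n powr (1/4)\<close> vertices are left uses \<open>O(sqrt (n / ln n))\<close> sets.
\<close>

section \<open>Counting estimates for one class of independent sets\<close>

text \<open>Pairing each \<open>Y\<close> with its complement in \<open>X\<close> gives every pair
  total size \<open>card X\<close>.\<close>

lemma sum_card_Pow:
  assumes "finite X"
  shows "2 * (\<Sum>Y\<in>Pow X. real (card Y)) = real (card X) * 2 ^ card X"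
proof -
  have "(\<Sum>Y\<in>Pow X. real (card Y)) = (\<Sum>Y\<in>Pow X. real (card (X - Y)))"
    by (rule sum.reindex_bij_witness[where i = "\<lambda>Y. X - Y" and j = "\<lambda>Y. X - Y"])
      (auto simp: double_diff)
  then have "2 * (\<Sum>Y\<in>Pow X. real (card Y)) = (\<Sum>Y\<in>Pow X. real (card Y) + real (card (X - Y)))"
    by (simp add: sum.distrib)
  also have "\<dots> = (\<Sum>Y\<in>Pow X. real (card X))"
  proof (rule sum.cong[OF refl])
    fix Y assume "Y \<in> Pow X"
    then show "real (card Y) + real (card (X - Y)) = real (card X)"
      using assms card_mono[of X Y] finite_subset[of Y X] by (simp add: card_Diff_subset)
  qed
  also have "\<dots> = real (card X) * 2 ^ card X"
    using assms by (simp add: card_Pow)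
  finally show ?thesis .
qed

text \<open>In \<open>indep_weight_sum\<close> a class has \<open>2 ^ x + 1\<close> members, and the
  right-hand side is their total weight. If \<open>2 ^ x \<le> sqrt d\<close>, the term
  \<open>d\<close> suffices because \<open>ln d \<le> 2 * sqrt d\<close>; otherwise \<open>x\<close>
  is at least \<open>ln d / 2\<close>.\<close>

lemma ln_weight_bound:
  fixes d :: real
  assumes "1 \<le> d"
  shows "ln d / 8 * (2 ^ x + 1) \<le> d + real x * 2 ^ x / 2"
proof (cases "2 ^ x \<le> sqrt d")
  case True
  have s: "1 \<le> sqrt d" using assms by simp
  have "ln (sqrt d) \<le> sqrt d - 1" using s by (intro ln_le_minus_one) auto
  then have l: "ln d \<le> 2 * sqrt d" using assms by (simp add: ln_sqrt)
  have pow_le: "2 ^ x + 1 \<le> 2 * sqrt d" using True s by linarith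
  have "ln d / 8 * (2 ^ x + 1) \<le> (2 * sqrt d) / 8 * (2 * sqrt d)"
    using pow_le s l assms by (intro mult_mono) auto
  also have "\<dots> = d / 2" using assms by simp
  also have "\<dots> \<le> d + real x * 2 ^ x / 2" using assms by (simp add: add_increasing2)
  finally show ?thesis .
next
  case False
  then have "ln (sqrt d) \<le> ln (2 ^ x)" using assms by (subst ln_le_cancel_iff) auto
  then have "ln d / 2 \<le> real x * ln 2" using assms by (simp add: ln_sqrt ln_realpow)
  also have "\<dots> \<le> real x" using ln_2_less_1 by (simp add: mult_left_le)
  finally have l: "ln d \<le> 2 * real x" by simp
  have "ln d / 8 * (2 ^ x + 1) \<le> (2 * real x) / 8 * (2 * 2 ^ x)"
    using l assms by (intro mult_mono) auto
  also have "\<dots> \<le> d + real x * 2 ^ x / 2" using assms by simp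
  finally show ?thesis .
qed

section \<open>Large independent sets in triangle-free graphs\<close>

text \<open>Adjacency lives on the whole type, so passing to an induced subgraph only changes the
  finite set \<open>V\<close> in the lemmas. Taking \<open>x = y = z\<close> in
  \<open>no_triangle\<close> rules out loops.\<close>

locale triangle_free_relation =
  fixes adj :: "'a \<Rightarrow> 'a \<Rightarrow> bool"
  assumes sym: "adj x y \<Longrightarrow> adj y x"
    and no_triangle: "adj x y \<Longrightarrow> adj y z \<Longrightarrow> \<not> adj x z"
begin

lemma irrefl: "\<not> adj x x"
  using no_triangle by blast

definition indep :: "'a set \<Rightarrow> bool" where
  "indep A \<longleftrightarrow> (\<forall>x\<in>A. \<forall>y\<in>A. \<not> adj x y)"

text \<open>
  The independent sets are grouped by their part \<open>H\<close> outside the closed neighbourhood of \<open>v\<close>.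
  Those with given \<open>H\<close> are \<open>insert v H\<close> and the sets \<open>H \<union> Y\<close> with \<open>Y \<subseteq> X\<close>, where \<open>X\<close> consists of
  the neighbours of \<open>v\<close> with no neighbour in \<open>H\<close>.
\<close>

lemma indep_weight_sum:
  fixes d :: real
  assumes fin: "finite V" and v: "v \<in> V" and d: "1 \<le> d"
  defines "I \<equiv> {W. W \<subseteq> V \<and> indep W}"
  shows "ln d / 8 * real (card I) \<le> (\<Sum>W\<in>I. d * of_bool (v \<in> W) + real (card {u \<in> W. adj v u}))"
proof -
  define f where "f W = d * of_bool (v \<in> W) + real (card {u \<in> W. adj v u})" for W
  define N where "N = {u \<in> V. adj v u}"
  define r where "r W = W - insert v N" for W
  define \<kappa> where "\<kappa> = ln d / 8"
  have finI: "finite I" using fin unfolding I_def by simp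
  \<comment> \<open>It suffices that each class has average weight at least \<open>\<kappa>\<close>;
    subtracting \<open>\<kappa>\<close> from every member expresses this without dividing by the
    class size.\<close>
  have "0 \<le> (\<Sum>W\<in>{W\<in>I. r W = H}. f W - \<kappa>)" if H: "H \<in> r ` I" for H
  proof -
    define X where "X = {u \<in> N. \<forall>h\<in>H. \<not> adj u h}"
    have HV: "H \<subseteq> V" "indep H" "H \<inter> insert v N = {}" "finite H"
      using H fin unfolding r_def I_def indep_def by (auto intro: finite_subset)
    have Hv: "\<not> adj v h" "\<not> adj h v" if "h \<in> H" for h
      using that HV sym unfolding N_def by blast+
    have vN: "v \<notin> N" using irrefl by (auto simp: N_def)
    \<comment> \<open>Triangle-freeness enters here: the neighbourhood of \<open>v\<close> is
      independent, so \<open>Y\<close> may be any subset of \<open>X\<close>.\<close>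
    have NN: "\<not> adj a b" if "a \<in> N" "b \<in> N" for a b
      using that no_triangle[of v a b] by (auto simp: N_def)
    have finX: "finite X" using fin by (simp add: X_def N_def)
    have fib: "{W\<in>I. r W = H} = insert (insert v H) ((\<union>) H ` Pow X)"
    proof (intro set_eqI iffI)
      fix W assume W: "W \<in> {W\<in>I. r W = H}"
      show "W \<in> insert (insert v H) ((\<union>) H ` Pow X)"
      proof (cases "v \<in> W")
        case True
        then have "W \<inter> N = {}" using W by (auto simp: I_def indep_def N_def)
        then have "W = insert v H" using W True by (auto simp: r_def)
        then show ?thesis by simp
      next
        case False
        then have "W = H \<union> (W \<inter> N)" using W by (auto simp: r_def)
        moreover have "W \<inter> N \<subseteq> X" using W by (auto simp: X_def I_def indep_def r_def)
        ultimately show ?thesis by blast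
      qed
    next
      fix W assume "W \<in> insert (insert v H) ((\<union>) H ` Pow X)"
      then consider "W = insert v H" | Y where "Y \<subseteq> X" "W = H \<union> Y" by blast
      then show "W \<in> {W\<in>I. r W = H}"
      proof cases
        case 1
        then show ?thesis using HV Hv irrefl v by (auto simp: I_def indep_def r_def)
      next
        case 2
        have "indep W" unfolding indep_def
        proof (intro ballI)
          fix x y assume "x \<in> W" "y \<in> W"
          then show "\<not> adj x y"
            using 2 HV(2) NN sym[of x y] unfolding X_def indep_def by blast
        qed
        moreover have "W \<subseteq> V" using 2 HV by (auto simp: X_def N_def)
        moreover have "r W = H" using 2 HV by (auto simp: X_def r_def)
        ultimately show ?thesis by (simp add: I_def)
      qed
    qed
    have HX: "H \<inter> X = {}" using HV by (auto simp: X_def)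
    have inj: "inj_on ((\<union>) H) (Pow X)" using HX by (auto simp: inj_on_def)
    have nin: "insert v H \<notin> (\<union>) H ` Pow X" using HV vN by (auto simp: X_def)
    have "{u \<in> insert v H. adj v u} = {}" using Hv irrefl by auto
    then have f1: "f (insert v H) = d" unfolding f_def by (simp only: card.empty) simp
    have f2: "f (H \<union> Y) = real (card Y)" if "Y \<in> Pow X" for Y
    proof -
      have "{u \<in> H \<union> Y. adj v u} = Y" using that Hv by (auto simp: X_def N_def)
      moreover have "v \<notin> H \<union> Y" using that vN HV by (auto simp: X_def)
      ultimately show ?thesis by (simp add: f_def)
    qed
    have "(\<Sum>W\<in>{W\<in>I. r W = H}. f W - \<kappa>) = d - \<kappa> + (\<Sum>Y\<in>Pow X. f (H \<union> Y) - \<kappa>)"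
      unfolding fib using nin finX f1 by (simp add: sum.reindex[OF inj])
    also have "(\<Sum>Y\<in>Pow X. f (H \<union> Y) - \<kappa>) = (\<Sum>Y\<in>Pow X. real (card Y) - \<kappa>)"
      using f2 by (intro sum.cong) auto
    also have "\<dots> = real (card X) * 2 ^ card X / 2 - 2 ^ card X * \<kappa>"
      using sum_card_Pow[OF finX] finX by (simp add: sum_subtractf card_Pow)
    finally show ?thesis
      using ln_weight_bound[OF d, of "card X"] by (simp add: \<kappa>_def algebra_simps)
  qed
  then have "0 \<le> (\<Sum>W\<in>I. f W - \<kappa>)"
    by (subst sum.image_gen[OF finI, of _ r]) (auto intro: sum_nonneg)
  then show ?thesis by (simp add: sum_subtractf f_def \<kappa>_def mult.commute)
qed

text \<open>Double counting: summed over \<open>v\<close>, the weights of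
  \<open>indep_weight_sum\<close> count each vertex of \<open>W\<close> with \<open>d\<close> plus
  its degree, at most \<open>2 * d\<close>. Averaged over all independent sets the sum is at least
  \<open>card V * ln d / 8\<close>, so some \<open>W\<close> has the claimed size.\<close>

lemma exists_indep_of_degree:
  fixes d :: real
  assumes fin: "finite V" and d: "1 \<le> d"
    and deg: "\<And>v. v \<in> V \<Longrightarrow> real (card {u \<in> V. adj v u}) \<le> d"
  shows "\<exists>W\<subseteq>V. indep W \<and> real (card V) * ln d / (16 * d) \<le> real (card W)"
proof (rule ccontr)
  assume neg: "\<not> ?thesis"
  define I where "I = {W. W \<subseteq> V \<and> indep W}"
  define f where "f v W = d * of_bool (v \<in> W) + real (card {u \<in> W. adj v u})" for v W
  have finI: "finite I" using fin unfolding I_def by simp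
  have neI: "{} \<in> I" by (simp add: I_def indep_def)
  have up: "(\<Sum>v\<in>V. f v W) < real (card V) * (ln d / 8)" if "W \<in> I" for W
  proof -
    have WV: "W \<subseteq> V" "finite W" using that fin by (auto simp: I_def intro: finite_subset)
    have "(\<Sum>v\<in>V. real (card {u \<in> W. adj v u})) = (\<Sum>v\<in>V. \<Sum>u\<in>W. of_bool (adj v u))"
      using WV by (simp add: Int_def)
    also have "\<dots> = (\<Sum>u\<in>W. \<Sum>v\<in>V. of_bool (adj v u))" by (rule sum.swap)
    also have "\<dots> = (\<Sum>u\<in>W. real (card {v \<in> V. adj u v}))"
      using fin sym by (intro sum.cong) (auto simp: Int_def intro!: arg_cong[where f = card])
    also have "\<dots> \<le> (\<Sum>u\<in>W. d)" using deg WV by (intro sum_mono) auto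
    finally have 1: "(\<Sum>v\<in>V. real (card {u \<in> W. adj v u})) \<le> d * card W" by (simp add: mult.commute)
    have "(\<Sum>v\<in>V. d * of_bool (v \<in> W)) = d * card W"
      using WV fin by (simp add: sum_distrib_left[symmetric] Int_absorb1)
    then have "(\<Sum>v\<in>V. f v W) \<le> 2 * d * card W" using 1 by (simp add: f_def sum.distrib)
    also have "\<dots> < 2 * d * (real (card V) * ln d / (16 * d))"
      using neg that d by (intro mult_strict_left_mono) (auto simp: I_def not_le)
    also have "\<dots> = real (card V) * (ln d / 8)" using d by simp
    finally show ?thesis .
  qed
  have "real (card V) * (ln d / 8) * card I = (\<Sum>v\<in>V. ln d / 8 * real (card I))" by simp
  also have "\<dots> \<le> (\<Sum>v\<in>V. \<Sum>W\<in>I. f v W)"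
    using indep_weight_sum[OF fin _ d] unfolding f_def I_def by (intro sum_mono) auto
  also have "\<dots> = (\<Sum>W\<in>I. \<Sum>v\<in>V. f v W)" by (rule sum.swap)
  \<comment> \<open>Strictness survives the summation because \<open>I\<close> contains the empty
    set.\<close>
  also have "\<dots> < (\<Sum>W\<in>I. real (card V) * (ln d / 8))"
    using up neI finI by (intro sum_strict_mono) auto
  finally show False by (simp add: mult.commute)
qed

text \<open>The threshold \<open>d = sqrt (m * ln m)\<close> balances two cases: a vertex with more
  than \<open>d\<close> neighbours has an independent neighbourhood of that size, and otherwise the
  degree bound yields \<open>m * ln d / (16 * d)\<close>, which is at least
  \<open>d / 32\<close>.\<close>

lemma exists_indep:
  assumes fin: "finite V" and m: "3 \<le> card V"
  shows "\<exists>W\<subseteq>V. indep W \<and> sqrt (real (card V) * ln (real (card V))) / 32 \<le> real (card W)"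
proof -
  define m where "m = real (card V)"
  define d where "d = sqrt (m * ln m)"
  have m3: "3 \<le> m" using m by (simp add: m_def)
  \<comment> \<open>From \<open>ln m \<ge> 1\<close> follows \<open>sqrt m \<le> d\<close>, so
    \<open>ln d\<close> is at least half of \<open>ln m\<close>.\<close>
  have "exp 1 \<le> m" using exp_le m3 by linarith
  then have l1: "1 \<le> ln m" using m3 by (subst ln_ge_iff) auto
  then have md: "m \<le> m * ln m" using m3 by simp
  then have sd: "sqrt m \<le> d" unfolding d_def by simp
  have d1: "1 \<le> d" using sd m3 by (smt (verit) real_sqrt_ge_one)
  show ?thesis
  proof (cases "\<exists>v\<in>V. d < real (card {u \<in> V. adj v u})")
    case True
    then obtain v where "v \<in> V" "d < real (card {u \<in> V. adj v u})" by blast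
    moreover have "indep {u \<in> V. adj v u}" using no_triangle by (auto simp: indep_def)
    moreover have "d / 32 \<le> d" using d1 by simp
    ultimately show ?thesis unfolding d_def m_def
      by (intro exI[of _ "{u \<in> V. adj v u}"]) auto
  next
    case False
    then obtain W where W: "W \<subseteq> V" "indep W" "m * ln d / (16 * d) \<le> real (card W)"
      using exists_indep_of_degree[OF fin d1] unfolding m_def by force
    have "ln (sqrt m) \<le> ln d" using sd m3 d1 by (subst ln_le_cancel_iff) auto
    then have "ln m / 2 \<le> ln d" using m3 by (simp add: ln_sqrt)
    then have "m * (ln m / 2) / (16 * d) \<le> m * ln d / (16 * d)"
      using m3 d1 by (intro divide_right_mono mult_left_mono) auto
    moreover have "m * (ln m / 2) / (16 * d) = d / 32"
    proof -
      have "d * d = m * ln m" using m3 l1 by (simp add: d_def)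
      then show ?thesis using d1 by (simp add: field_simps)
    qed
    ultimately have "d / 32 \<le> real (card W)" using W by linarith
    then show ?thesis using W unfolding d_def m_def by blast
  qed
qed

section \<open>Greedy partitions into independent sets\<close>

text \<open>Independent sets are extracted while more than \<open>T\<close> vertices remain, so
  \<open>L\<close> stays a lower bound for the logarithm of the current size. The potential
  \<open>64 / sqrt L * sqrt (card V)\<close> pays for each extracted set, and the last vertices, at
  most \<open>T\<close>, become singletons.\<close>

lemma indep_partition:
  fixes L :: real
  assumes "finite V" and "0 < L" and "3 \<le> T" and "L \<le> ln T"
  shows "\<exists>P. partition_on V P \<and> finite P \<and> (\<forall>A\<in>P. indep A) \<and>
    real (card P) \<le> 64 / sqrt L * sqrt (real (card V)) + real T"
  using assms(1)
proof (induction "card V" arbitrary: V rule: less_induct)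
  case less
  show ?case
  proof (cases "T < card V")
    case False
    define P where "P = (\<lambda>x. {x}) ` V"
    have "partition_on V P" unfolding partition_on_def P_def disjoint_def by auto
    moreover have "card P \<le> card V" unfolding P_def using less.prems by (rule card_image_le)
    moreover have "0 \<le> 64 / sqrt L * sqrt (real (card V))" using \<open>0 < L\<close> by simp
    ultimately show ?thesis using False irrefl less.prems
      by (intro exI[of _ P]) (auto simp: P_def indep_def)
  next
    case True
    define m where "m = real (card V)"
    obtain W where W: "W \<subseteq> V" "indep W" "sqrt (m * ln m) / 32 \<le> real (card W)"
      using exists_indep[OF less.prems] True \<open>3 \<le> T\<close> unfolding m_def by force
    have mT: "real T \<le> m" "0 < m" using True by (simp_all add: m_def)
    have "ln (real T) \<le> ln m" using mT \<open>3 \<le> T\<close> by (subst ln_le_cancel_iff) auto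
    then have "sqrt (m * L) \<le> sqrt (m * ln m)" using assms(4) mT by simp
    then have w: "sqrt m * sqrt L / 32 \<le> real (card W)" using W by (simp add: real_sqrt_mult)
    have finW: "finite W" using W less.prems by (auto intro: finite_subset)
    have "0 < real (card W)" using w mT \<open>0 < L\<close>
      by (smt (verit) divide_pos_pos mult_pos_pos real_sqrt_gt_zero)
    then have W0: "W \<noteq> {}" "0 < card W" by auto
    have wle: "card W \<le> card V" using W less.prems by (simp add: card_mono)
    have cd: "card (V - W) = card V - card W" using W finW by (simp add: card_Diff_subset)
    then have "card (V - W) < card V" using W0 wle by linarith
    then obtain P where P: "partition_on (V - W) P" "finite P" "\<forall>A\<in>P. indep A"
      "real (card P) \<le> 64 / sqrt L * sqrt (real (card (V - W))) + real T"
      using less.hyps[of "V - W"] less.prems by auto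
    have "disjnt W (\<Union>P)" using partition_onD1[OF P(1)] by (auto simp: disjnt_def)
    then have "partition_on V (insert W P)" using P(1) W0 W by (simp add: partition_on_insert)
    moreover have "real (card (insert W P)) \<le> real (card P) + 1"
      using P(2) by (simp add: card_insert_if)
    moreover have "64 / sqrt L * sqrt (real (card (V - W))) + 1 \<le> 64 / sqrt L * sqrt m"
    proof -
      (* One step decreases sqrt m by at least sqrt L / 64. *)
      define s where "s = sqrt (real (card (V - W)))"
      have s2: "s * s = m - real (card W)" using cd wle by (simp add: s_def m_def of_nat_diff)
      have s0: "0 \<le> s" "s \<le> sqrt m" using cd by (auto simp: s_def m_def)
      have "sqrt m * (sqrt L / 32) \<le> sqrt m * sqrt m - s * s" using s2 w mT by simp
      also have "\<dots> = (sqrt m + s) * (sqrt m - s)" by (simp add: algebra_simps)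
      also have "\<dots> \<le> (2 * sqrt m) * (sqrt m - s)" using s0 by (intro mult_right_mono) auto
      also have "\<dots> = sqrt m * (2 * (sqrt m - s))" by (simp only: mult.assoc mult.left_commute)
      finally have "sqrt L / 32 \<le> 2 * (sqrt m - s)"
        using mT by (simp only: mult_le_cancel_left_pos real_sqrt_gt_zero)
      then have "64 / sqrt L * (sqrt L / 64) \<le> 64 / sqrt L * (sqrt m - s)"
        using \<open>0 < L\<close> by (intro mult_left_mono) auto
      then show ?thesis using \<open>0 < L\<close> by (simp add: s_def[symmetric] right_diff_distrib)
    qed
    ultimately show ?thesis using P W(2) unfolding m_def
      by (intro exI[of _ "insert W P"]) auto
  qed
qed

end

section \<open>Dichromatic numbers of orientations\<close>

lemma acyclic_digraph_no_arcs:
  assumes "arcs D = {}"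
  shows "acyclic_digraph D"
  using assms unfolding acyclic_digraph_def pre_digraph.cycle_def pre_digraph.awalk_def by auto

lemma verts_orient [simp]: "verts (orient G h) = uverts G"
  and tail_orient [simp]: "tail (orient G h) = fst"
  and head_orient [simp]: "head (orient G h) = snd"
  and arcs_orient: "arcs (orient G h) = {(u, v). {u, v} \<in> uedges G \<and> h {u, v} = v}"
  by (simp_all add: orient_def)

lemma acyclic_orient_restrict_no_edges:
  assumes "\<And>x y. x \<in> A \<Longrightarrow> y \<in> A \<Longrightarrow> {x, y} \<notin> uedges G"
  shows "acyclic_digraph (orient G h \<restriction> A)"
  using assms by (intro acyclic_digraph_no_arcs) (auto simp: arcs_orient induce_subgraph_arcs)

text \<open>A singleton is acyclic. Together with property (i) this yields
  \<open>k n \<ge> 2\<close>, so the denominator in property (ii) is positive.\<close>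

lemma acyclic_number_orient_pos:
  assumes "simple_graph G" and "v \<in> uverts G"
  shows "0 < acyclic_number (orient G h)"
proof -
  let ?S = "{card U | U. acyclic_vertex_set (orient G h) U}"
  have fin: "finite (uverts G)" using assms by (simp add: simple_graph_def)
  have "{x, x} \<notin> uedges G" for x using assms by (auto simp: simple_graph_def)
  then have "acyclic_vertex_set (orient G h) {v}"
    using assms by (auto simp: acyclic_vertex_set_def intro: acyclic_orient_restrict_no_edges)
  then have "card {v} \<in> ?S" by blast
  moreover have "?S \<subseteq> card ` Pow (uverts G)" by (auto simp: acyclic_vertex_set_def)
  then have "finite ?S" using fin finite_subset by blast
  ultimately have "card {v} \<le> Max ?S" by (intro Max_ge)
  then show ?thesis by (simp add: acyclic_number_def)
qed

lemma dichromatic_number_le: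
  assumes "partition_on (verts D) P" and "finite P" and "\<And>A. A \<in> P \<Longrightarrow> acyclic_vertex_set D A"
  shows "dichromatic_number D \<le> card P"
  unfolding dichromatic_number_def using assms by (intro Least_le) blast

text \<open>No orientation has an arc inside an independent set, so the partition of the underlying
  graph works for every \<open>h\<close>.\<close>

lemma dichromatic_number_orient_le:
  fixes L :: real
  assumes G: "simple_graph G" "triangle_free G" and W: "W \<subseteq> uverts G"
    and L: "0 < L" "3 \<le> T" "L \<le> ln (real T)"
  shows "real (dichromatic_number (orient G h \<restriction> W)) \<le> 64 / sqrt L * sqrt (real (card W)) + real T"
proof -
  interpret triangle_free_relation "\<lambda>x y. {x, y} \<in> uedges G"
    using G(2) by unfold_locales (auto simp: triangle_free_def insert_commute)
  have "finite W" using G(1) W finite_subset by (auto simp: simple_graph_def)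
  then obtain P where P: "partition_on W P" "finite P" "\<forall>A\<in>P. indep A"
    "real (card P) \<le> 64 / sqrt L * sqrt (real (card W)) + real T"
    using indep_partition L by blast
  have "acyclic_vertex_set (orient G h \<restriction> W) A" if A: "A \<in> P" for A
  proof -
    have "A \<subseteq> W" using A P(1) by (auto simp: partition_on_def)
    moreover have "arcs ((orient G h \<restriction> W) \<restriction> A) = {}"
      using A P(3) by (auto simp: indep_def arcs_orient induce_subgraph_arcs)
    ultimately show ?thesis
      by (simp add: acyclic_vertex_set_def acyclic_digraph_no_arcs)
  qed
  then have "dichromatic_number (orient G h \<restriction> W) \<le> card P"
    using P by (intro dichromatic_number_le) auto
  then show ?thesis using P(4) by linarith
qed

text \<open>With \<open>T\<close> near \<open>n powr (1/4)\<close>, the additive term is negligible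
  while \<open>ln T\<close> is still at least \<open>ln n / 4\<close>. Graph, orientation and
  \<open>W\<close> are quantified inside the eventuality to make the threshold for \<open>n\<close>
  uniform.\<close>

lemma eventually_dichromatic_number_le:
  "\<forall>\<^sub>F n in sequentially. \<forall>(G :: 'a ugraph) h W. simple_graph G \<longrightarrow> triangle_free G \<longrightarrow>
     card (uverts G) = n \<longrightarrow> W \<subseteq> uverts G \<longrightarrow>
     real (dichromatic_number (orient G h \<restriction> W)) \<le> 129 * sqrt (real n / ln (real n))"
proof -
  have "\<forall>\<^sub>F n :: nat in sequentially. real n powr (1/4) + 4 \<le> sqrt (real n / ln (real n))"
    by real_asymp
  then show ?thesis using eventually_ge_at_top[of 2]
  proof eventually_elim
    case (elim n)
    \<comment> \<open>The summand 3 secures \<open>3 \<le> T\<close>; rounding up costs at most 1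
      more, hence the 4 in the bounds.\<close>
    define T where "T = nat \<lceil>real n powr (1/4)\<rceil> + 3"
    define L where "L = ln (real n) / 4"
    have n: "2 \<le> real n" "0 < ln (real n)" using elim by auto
    have T: "real n powr (1/4) \<le> real T" "real T \<le> real n powr (1/4) + 4"
    proof -
      have "0 \<le> \<lceil>real n powr (1/4)\<rceil>" using powr_ge_zero[of "real n" "1/4"] by linarith
      then show "real n powr (1/4) \<le> real T" "real T \<le> real n powr (1/4) + 4"
        unfolding T_def by linarith+
    qed
    have "L = ln (real n powr (1/4))" using n by (simp add: L_def ln_powr)
    also have "\<dots> \<le> ln (real T)" using T n by (intro ln_mono) auto
    finally have L: "L \<le> ln (real T)" .
    show ?case
    proof (intro allI impI)
      fix G :: "'a ugraph" and h W
      assume G: "simple_graph G" "triangle_free G" "card (uverts G) = n" "W \<subseteq> uverts G"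
      have "card W \<le> n" using G card_mono by (auto simp: simple_graph_def)
      have "real (dichromatic_number (orient G h \<restriction> W)) \<le> 64 / sqrt L * sqrt (real (card W)) + real T"
        using G L n by (intro dichromatic_number_orient_le) (auto simp: L_def T_def)
      also have "\<dots> \<le> 64 / sqrt L * sqrt (real n) + sqrt (real n / ln (real n))"
        using \<open>card W \<le> n\<close> T elim n by (intro add_mono mult_left_mono) (auto simp: L_def)
      \<comment> \<open>\<open>sqrt L\<close> is half of \<open>sqrt (ln n)\<close>, which doubles
        64; \<open>T\<close> accounts for the remaining unit of 129.\<close>
      also have "64 / sqrt L * sqrt (real n) = 128 * sqrt (real n / ln (real n))"
        by (simp add: L_def real_sqrt_divide)
      finally show "real (dichromatic_number (orient G h \<restriction> W)) \<le> 129 * sqrt (real n / ln (real n))"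
        by simp
    qed
  qed
qed

section \<open>From robustness to probability tending to one\<close>

lemma set_random_orientation: "set_pmf (random_orientation G) \<subseteq> range (orient G)"
  by (auto simp: random_orientation_def)

lemma prob_ge_one_minus:
  assumes "set_pmf p - B \<subseteq> A"
  shows "1 - measure_pmf.prob p B \<le> measure_pmf.prob p A"
proof -
  have "1 - measure_pmf.prob p B = measure_pmf.prob p (- B)"
    by (subst measure_pmf.prob_compl[symmetric]) (auto simp: Compl_eq_Diff_UNIV)
  also have "\<dots> = measure_pmf.prob p (- B \<inter> set_pmf p)" by (simp add: measure_Int_set_pmf)
  also have "\<dots> \<le> measure_pmf.prob p A" using assms by (intro measure_pmf.finite_measure_mono) auto
  finally show ?thesis .
qed

text \<open>The event \<open>A\<close> is abstract so that one argument serves both claims: it only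
  has to contain each digraph satisfying the lower and the upper bound. The factor
  \<open>lam / C\<close> comes from dividing \<open>lam * n\<close> by the bound on
  \<open>k n\<close>.\<close>

lemma robust_imp_prob_tendsto_1:
  fixes G :: "nat \<Rightarrow> 'a ugraph" and C c :: real
  assumes "robust \<zeta> C c G k" and "0 < lam" and "0 < C" and "0 < c"
    and A: "\<And>n D. (\<And>W. W \<subseteq> uverts (G n) \<Longrightarrow> lam * real n \<le> real (card W) \<Longrightarrow>
        lam / C * sqrt (real n / ln (real n)) \<le> real (dichromatic_number (D \<restriction> W))) \<Longrightarrow>
      (\<And>W. W \<subseteq> uverts (G n) \<Longrightarrow>
        real (dichromatic_number (D \<restriction> W)) \<le> 129 * sqrt (real n / ln (real n))) \<Longrightarrow>
      card (uverts (G n)) = n \<Longrightarrow> finite (uverts (G n)) \<Longrightarrow> D \<in> A n"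
  shows "(\<lambda>n. measure_pmf.prob (random_orientation (G n)) (A n)) \<longlonglongrightarrow> 1"
proof -
  \<comment> \<open>This puts every set of at least \<open>lam * n\<close> vertices within the range
    of property (ii), which requires at least \<open>k n\<close> vertices.\<close>
  have big: "\<forall>\<^sub>F n :: nat in sequentially. C * sqrt (real n * ln (real n)) \<le> lam * real n"
    using \<open>0 < lam\<close> \<open>0 < C\<close> by real_asymp
  have lim: "(\<lambda>n. 1 - exp (- (c * sqrt (real n) * ln (real n) powr (3/2)))) \<longlonglongrightarrow> 1"
    using \<open>0 < c\<close> by real_asymp
  have "\<forall>\<^sub>F n in sequentially. 1 - exp (- (c * sqrt (real n) * ln (real n) powr (3/2)))
      \<le> measure_pmf.prob (random_orientation (G n)) (A n)"
    using assms(1)[unfolded robust_def] big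
      eventually_dichromatic_number_le[where 'a = 'a] eventually_ge_at_top[of 2]
  proof eventually_elim
    case (elim n)
    let ?p = "random_orientation (G n)" and ?B = "small_fas_event \<zeta> (G n) (k n)"
    have G: "simple_graph (G n)" "card (uverts (G n)) = n" "triangle_free (G n)"
      and kC: "real_of_int (k n) \<le> C * sqrt (real n * ln (real n))"
      and prB: "measure_pmf.prob ?p ?B \<le> exp (- (c * sqrt (real n) * ln (real n) powr (3/2)))"
      using elim(1) by blast+
    have rob: "\<forall>D\<in>set_pmf ?p - ?B. int (acyclic_number D) < k n \<and>
        (\<forall>W\<subseteq>uverts (G n). k n \<le> int (card W) \<longrightarrow>
          real (card W) / real_of_int (k n - 1) \<le> real (dichromatic_number (D \<restriction> W)))"
      using elim(1) by blast
    have fin: "finite (uverts (G n))" using G by (simp add: simple_graph_def)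
    have n: "2 \<le> n" "0 < ln (real n)" using elim(4) by auto
    have "set_pmf ?p - ?B \<subseteq> A n"
    proof
      fix D assume D: "D \<in> set_pmf ?p - ?B"
      obtain h where h: "D = orient (G n) h" using D set_random_orientation by blast
      obtain v where "v \<in> uverts (G n)" using G n by fastforce
      then have "0 < acyclic_number D" using acyclic_number_orient_pos[OF G(1)] h by simp
      moreover have "int (acyclic_number D) < k n" using D rob by blast
      ultimately have k: "2 \<le> k n" by linarith
      show "D \<in> A n"
      proof (rule A)
        fix W assume W: "W \<subseteq> uverts (G n)" "lam * real n \<le> real (card W)"
        have "real_of_int (k n) \<le> real (card W)" using kC elim(2) W by linarith
        then have "int (card W) \<ge> k n" by linarith
        then have 1: "real (card W) / real_of_int (k n - 1) \<le> real (dichromatic_number (D \<restriction> W))"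
          using rob D W by blast
        have "lam / C * sqrt (real n / ln (real n)) = lam * real n / (C * sqrt (real n * ln (real n)))"
          using n \<open>0 < C\<close> by (simp add: real_sqrt_divide real_sqrt_mult field_simps)
        also have "\<dots> \<le> real (card W) / real_of_int (k n - 1)"
          using W k kC n \<open>0 < lam\<close> by (intro frac_le) auto
        finally show "lam / C * sqrt (real n / ln (real n)) \<le> real (dichromatic_number (D \<restriction> W))"
          using 1 by linarith
      qed (use elim(3) G h fin in auto)
    qed
    then show ?case using prob_ge_one_minus[of ?p ?B "A n"] prB by linarith
  qed
  then show ?thesis
    by (intro tendsto_sandwich[OF _ _ lim tendsto_const]) auto
qed

theorem corollary4p3:
  fixes \<zeta> lam C c :: real
  assumes "0 < \<zeta>" and "\<zeta> < 1/2" and "0 < lam" and "0 < C" and "0 < c"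
  shows "\<exists>cl > 0. \<exists>a > 0. \<exists>b > 0. \<forall>(G :: nat \<Rightarrow> 'a ugraph) (k :: nat \<Rightarrow> int).
    robust \<zeta> C c G k \<longrightarrow>
      ((\<lambda>n. measure_pmf.prob (random_orientation (G n))
         {D. \<forall>W \<subseteq> uverts (G n). real (card W) \<ge> lam * real n \<longrightarrow>
               real (dichromatic_number (D \<restriction> W)) \<ge> cl * sqrt (real n / ln (real n))})
         \<longlonglongrightarrow> 1) \<and>
      ((\<lambda>n. measure_pmf.prob (random_orientation (G n))
         {D. \<forall>S \<subseteq> uverts (G n). real (card S) \<le> (1 - lam) * real n \<longrightarrow>
               a * sqrt (real n / ln (real n)) \<le> real (dichromatic_number (D \<restriction> (uverts (G n) - S))) \<and>
               real (dichromatic_number (D \<restriction> (uverts (G n) - S))) \<le> b * sqrt (real n / ln (real n))})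
         \<longlonglongrightarrow> 1)"
proof (rule exI[of _ "lam / C"], rule conjI[rotated], rule exI[of _ "lam / C"], rule conjI[rotated],
    rule exI[of _ 129], intro conjI allI impI)
  \<comment> \<open>The witness \<open>lam / C\<close> serves as both \<open>cl\<close> and
    \<open>a\<close>, and 129 as \<open>b\<close>. The rotated conjunctions leave the positivity
    goals to the closing \<open>auto\<close>.\<close>
  fix G :: "nat \<Rightarrow> 'a ugraph" and k
  assume r: "robust \<zeta> C c G k"
  show "(\<lambda>n. measure_pmf.prob (random_orientation (G n))
         {D. \<forall>W \<subseteq> uverts (G n). real (card W) \<ge> lam * real n \<longrightarrow>
               real (dichromatic_number (D \<restriction> W)) \<ge> lam / C * sqrt (real n / ln (real n))})
         \<longlonglongrightarrow> 1"
    by (rule robust_imp_prob_tendsto_1[OF r assms(3-5)]) auto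
  show "(\<lambda>n. measure_pmf.prob (random_orientation (G n))
         {D. \<forall>S \<subseteq> uverts (G n). real (card S) \<le> (1 - lam) * real n \<longrightarrow>
               lam / C * sqrt (real n / ln (real n)) \<le> real (dichromatic_number (D \<restriction> (uverts (G n) - S))) \<and>
               real (dichromatic_number (D \<restriction> (uverts (G n) - S))) \<le> 129 * sqrt (real n / ln (real n))})
         \<longlonglongrightarrow> 1"
  proof (rule robust_imp_prob_tendsto_1[OF r assms(3-5)], intro CollectI allI impI conjI)
    fix n S and D :: "('a, 'a \<times> 'a) pre_digraph"
    assume low: "\<And>W. W \<subseteq> uverts (G n) \<Longrightarrow> lam * real n \<le> real (card W) \<Longrightarrow>
        lam / C * sqrt (real n / ln (real n)) \<le> real (dichromatic_number (D \<restriction> W))"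
      and up: "\<And>W. W \<subseteq> uverts (G n) \<Longrightarrow>
        real (dichromatic_number (D \<restriction> W)) \<le> 129 * sqrt (real n / ln (real n))"
      and n: "card (uverts (G n)) = n" "finite (uverts (G n))"
      and S: "S \<subseteq> uverts (G n)" "real (card S) \<le> (1 - lam) * real n"
    \<comment> \<open>This makes the natural-number subtraction \<open>n - card S\<close> exact, so
      at least \<open>lam * n\<close> vertices survive and \<open>low\<close> applies.\<close>
    have "card S \<le> n" using card_mono[OF n(2) S(1)] n(1) by simp
    moreover have "card (uverts (G n) - S) = n - card S"
      using S n by (simp add: card_Diff_subset finite_subset)
    ultimately have "lam * real n \<le> real (card (uverts (G n) - S))"
      using S by (simp add: of_nat_diff algebra_simps)
    then show "lam / C * sqrt (real n / ln (real n)) \<le> real (dichromatic_number (D \<restriction> (uverts (G n) - S)))"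
      by (intro low) auto
    show "real (dichromatic_number (D \<restriction> (uverts (G n) - S))) \<le> 129 * sqrt (real n / ln (real n))"
      by (intro up) auto
  qed
qed (use assms in auto)

end
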